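(* Let $n\ge 1$ and let $1<p_1<\cdots<p_{n+1}$ be prime integers. Then the $n$-dimensional cube $(a\times\cdots\times a)$ (with $n$ sides equal to the positive integer $a$) can be tiled with the cubes $(p_1\times\cdots\times p_1),\dots,(p_{n+1}\times\cdots\times p_{n+1})$ (each with $n$ sides) if $$a> n\prod_{i=1}^{n+1}p_i-\sum_{i=1}^{n+1}\frac{p_1\cdots p_{n+1}}{p_i}.$$
   Context: $(a_1\times\cdots\times a_n)$ denotes the $n$-dimensional rectangle $\{(y_1,\dots,y_n)\in\mathbb{R}^n: 0\le y_i\le a_i\}$. A rectangle is tiled with bricks $B_1,\dots,B_k$ if it is the union of finitely many copies of the $B_i$ (translated, and rotations allowed) with pairwise disjoint interiors. *)

theory Defs
  imports "HOL-Analysis.Analysis" "HOL-Computational_Algebra.Primes"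
begin

definition rectangle :: "real ^ 'n \<Rightarrow> (real ^ 'n) set" where
  "rectangle a = cbox 0 a"

definition cube :: "nat \<Rightarrow> (real ^ 'n) set" where
  "cube a = rectangle (\<chi> i. real a)"

definition is_copy :: "(real ^ 'n) set \<Rightarrow> (real ^ 'n) set \<Rightarrow> bool" where
  "is_copy B S \<longleftrightarrow>
     (\<exists>Q t. rotation_matrix (Q :: real ^ 'n ^ 'n) \<and> S = (\<lambda>x. t + Q *v x) ` B)"

text \<open>
  A tiling is a set of tiles rather than a family; for bricks with nonempty interior
  this makes no difference, since disjointness of interiors excludes repeated tiles.
\<close>

definition can_be_tiled_with :: "(real ^ 'n) set \<Rightarrow> (real ^ 'n) set set \<Rightarrow> bool" where
  "can_be_tiled_with R \<B> \<longleftrightarrow>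
     (\<exists>\<T>. finite \<T> \<and>
          (\<forall>S\<in>\<T>. \<exists>B\<in>\<B>. is_copy B S) \<and>
          pairwise (\<lambda>S S'. interior S \<inter> interior S' = {}) \<T> \<and>
          \<Union>\<T> = R)"

end

theory Submission
  imports Defs "HOL-Number_Theory.Cong"
begin

text \<open>
  Put \<open>P = p\<^sub>1 \<cdots> p\<^sub>n\<^sub>+\<^sub>1\<close>. The bound on \<open>a\<close> is the Frobenius number of the integers
  \<open>P / p\<^sub>i\<close>, so \<open>a\<close> is a nonnegative integer combination of them, and \<open>[0, a]\<close> splits into
  segments each of length some \<open>P / p\<^sub>i\<close>. The product of these splittings cuts the cube into boxes.
  A box has only \<open>n\<close> sides, so some \<open>p\<^sub>j\<close> is such that no side has length \<open>P / p\<^sub>j\<close>; this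
  \<open>p\<^sub>j\<close> divides all sides of the box, which is therefore a grid of cubes of side \<open>p\<^sub>j\<close>.
\<close>

section \<open>The Frobenius bound\<close>

text \<open>Coefficients \<open>x i < p i\<close>, chosen modulo each \<open>p i\<close>, give a sum
  congruent to \<open>a\<close> modulo the full product, and the bound forces \<open>a\<close> to
  exceed that sum minus the product. The difference is thus a nonnegative multiple of the product,
  which one coefficient can absorb. The bound is stated over \<open>int\<close> since it can be
  negative: it is -1 for a singleton \<open>I\<close>.\<close>

lemma frobenius_complementary_products:
  fixes p :: "'i \<Rightarrow> nat" and a :: nat
  assumes fin: "finite I" and ne: "I \<noteq> {}"
    and pos: "\<And>i. i \<in> I \<Longrightarrow> p i > 0"
    and cop: "\<And>i j. i \<in> I \<Longrightarrow> j \<in> I \<Longrightarrow> i \<noteq> j \<Longrightarrow> coprime (p i) (p j)"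
    and big: "int a > (int (card I) - 1) * (\<Prod>i\<in>I. int (p i)) - (\<Sum>i\<in>I. \<Prod>j\<in>I-{i}. int (p j))"
  shows "\<exists>x. a = (\<Sum>i\<in>I. x i * (\<Prod>j\<in>I-{i}. p j))"
proof -
  define P where "P = (\<Prod>i\<in>I. p i)"
  define q where "q i = (\<Prod>j\<in>I-{i}. p j)" for i
  have Pq: "p i * q i = P" if "i \<in> I" for i
    using that fin by (simp add: P_def q_def prod.remove)
  \<comment> \<open>By coprimality \<open>q i\<close> is invertible modulo \<open>p i\<close>; its
    inverse times \<open>a\<close>, reduced modulo \<open>p i\<close>, is the coefficient.\<close>
  have "\<exists>x. x < p i \<and> [x * q i = a] (mod p i)" if i: "i \<in> I" for i
  proof -
    have "coprime (q i) (p i)"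
      unfolding q_def using i cop by (intro prod_coprime_left) auto
    then obtain y where "[q i * y = 1] (mod p i)"
      using cong_solve_coprime_nat by auto
    then have "[q i * y * a = 1 * a] (mod p i)" by (rule cong_scalar_right)
    then have "[(y * a) mod p i * q i = a] (mod p i)"
      by (simp add: cong_def mod_mult_left_eq mod_mult_right_eq mult_ac)
    then show ?thesis using pos[OF i] by (intro exI[of _ "(y * a) mod p i"]) simp
  qed
  then obtain x where x: "\<And>i. i \<in> I \<Longrightarrow> x i < p i"
    "\<And>i. i \<in> I \<Longrightarrow> [x i * q i = a] (mod p i)" by metis
  define S where "S = (\<Sum>i\<in>I. x i * q i)"
  have "[S = a] (mod p i)" if i: "i \<in> I" for i
  proof -
    \<comment> \<open>\<open>p i\<close> is a factor of \<open>q j\<close> for every other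
      \<open>j\<close>, so modulo \<open>p i\<close> only the \<open>i\<close>-th term of
      \<open>S\<close> survives.\<close>
    have "p i dvd x j * q j" if "j \<in> I - {i}" for j
      using that i fin unfolding q_def by (intro dvd_mult dvd_prodI) auto
    then have "p i dvd (\<Sum>j\<in>I-{i}. x j * q j)" by (rule dvd_sum)
    then have "[x i * q i + (\<Sum>j\<in>I-{i}. x j * q j) = a + 0] (mod p i)"
      by (intro cong_add x i) (simp add: cong_0_iff)
    then show ?thesis using i fin by (simp add: S_def sum.remove)
  qed
  then have "[S = a] (mod P)"
    unfolding P_def using cop by (intro coprime_cong_prod_nat) auto
  then have "int P dvd int a - int S"
    by (simp add: cong_iff_dvd_diff dvd_diff_commute flip: cong_int_iff)
  then obtain k where k: "int a - int S = int P * k" by blast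
  \<comment> \<open>Each \<open>x i\<close> is at most \<open>p i - 1\<close>, and
    \<open>(p i - 1) * q i = P - q i\<close>. The resulting upper bound for \<open>S\<close> exceeds
    the assumed lower bound for \<open>a\<close> by exactly \<open>P\<close>, whence
    \<open>a - S > -P\<close>.\<close>
  have "int S \<le> (\<Sum>i\<in>I. (int (p i) - 1) * int (q i))"
    unfolding S_def of_nat_sum of_nat_mult
    using x(1) by (intro sum_mono mult_right_mono) force+
  also have "\<dots> = (\<Sum>i\<in>I. int P - int (q i))"
    by (intro sum.cong refl) (simp add: left_diff_distrib Pq flip: of_nat_mult)
  also have "\<dots> = int (card I) * int P - (\<Sum>i\<in>I. int (q i))"
    by (simp add: sum_subtractf)
  finally have "int P * k > int P * (-1)"
    using big k by (simp add: P_def q_def left_diff_distrib)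
  then have "-1 < k" by (rule mult_left_less_imp_less) simp
  then have "k \<ge> 0" by simp
  then have a: "a = S + P * nat k"
    using k by (simp flip: of_nat_eq_iff[where 'a = int])
  obtain i0 where i0: "i0 \<in> I" using ne by blast
  \<comment> \<open>As \<open>p i0 * q i0 = P\<close>, raising one coefficient by
    \<open>p i0 * nat k\<close> adds \<open>P * nat k\<close>.\<close>
  have "(\<Sum>i\<in>I. (x(i0 := x i0 + p i0 * nat k)) i * q i)
      = (x i0 + p i0 * nat k) * q i0 + (\<Sum>i\<in>I-{i0}. x i * q i)"
    using fin i0 by (simp add: sum.remove)
  also have "\<dots> = S + P * nat k"
    using fin i0 by (simp add: S_def sum.remove algebra_simps flip: Pq[OF i0])
  finally show ?thesis using a unfolding q_def by metis
qed

text \<open>Turns a nonnegative combination into the breakpoints \<open>s\<close> of a subdivision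
  of the segment from 0 to the sum, built by appending one copy of some \<open>q i\<close> at a
  time.\<close>

lemma sum_as_chain:
  fixes q x :: "'i \<Rightarrow> nat"
  assumes "finite I"
  shows "\<exists>m s. s 0 = 0 \<and> s m = (\<Sum>i\<in>I. x i * q i) \<and> (\<forall>k<m. \<exists>i\<in>I. s (Suc k) = s k + q i)"
proof -
  define R where "R b \<longleftrightarrow> (\<exists>m s. s 0 = 0 \<and> s m = b \<and> (\<forall>k<m. \<exists>i\<in>I. s (Suc k) = s k + q i))"
    for b :: nat
  have R0: "R 0" unfolding R_def by (intro exI[of _ 0] exI[of _ "\<lambda>_. 0"]) simp
  have step: "R (b + q i)" if "R b" "i \<in> I" for b i
  proof -
    obtain m s where s: "s 0 = 0" "s m = b" "\<forall>k<m. \<exists>i\<in>I. s (Suc k) = s k + q i"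
      using \<open>R b\<close> unfolding R_def by blast
    then show ?thesis unfolding R_def using \<open>i \<in> I\<close>
      by (intro exI[of _ "Suc m"] exI[of _ "s(Suc m := b + q i)"]) (auto simp: less_Suc_eq)
  qed
  have steps: "R (b + t * q i)" if "R b" "i \<in> I" for b i t
  proof (induction t)
    case (Suc t)
    then show ?case using step[OF Suc \<open>i \<in> I\<close>] by (simp add: algebra_simps)
  qed (use that in simp)
  have "R (\<Sum>i\<in>J. x i * q i)" if "J \<subseteq> I" for J
    using finite_subset[OF that assms] that
  proof (induction J rule: finite_induct)
    case (insert j J)
    then show ?case using steps[of "\<Sum>i\<in>J. x i * q i" j "x j"] by (simp add: add.commute)
  qed (simp add: R0)
  then show ?thesis unfolding R_def by blast
qed

section \<open>Tilings\<close>

text \<open>The tile sets of the pieces are merged. Tiles from different pieces have disjoint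
  interiors because each tile lies in its piece and \<open>interior\<close> is monotone.\<close>

lemma can_be_tiled_with_UN:
  assumes fin: "finite K"
    and til: "\<And>k. k \<in> K \<Longrightarrow> can_be_tiled_with (R k) \<B>"
    and dis: "\<And>k l. k \<in> K \<Longrightarrow> l \<in> K \<Longrightarrow> k \<noteq> l \<Longrightarrow> interior (R k) \<inter> interior (R l) = {}"
  shows "can_be_tiled_with (\<Union>k\<in>K. R k) \<B>"
proof -
  obtain T where T: "\<And>k. k \<in> K \<Longrightarrow> finite (T k) \<and> (\<forall>S\<in>T k. \<exists>B\<in>\<B>. is_copy B S) \<and>
      pairwise (\<lambda>S S'. interior S \<inter> interior S' = {}) (T k) \<and> \<Union>(T k) = R k"
    using til unfolding can_be_tiled_with_def by metis
  have "interior S \<inter> interior S' = {}"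
    if "k \<in> K" "l \<in> K" "S \<in> T k" "S' \<in> T l" "S \<noteq> S'" for k l S S'
  proof (cases "k = l")
    case True
    then show ?thesis using T[OF \<open>k \<in> K\<close>] that unfolding pairwise_def by blast
  next
    case False
    have "S \<subseteq> R k" "S' \<subseteq> R l" using T that by blast+
    then show ?thesis using dis[OF that(1,2) False] interior_mono by blast
  qed
  then have "pairwise (\<lambda>S S'. interior S \<inter> interior S' = {}) (\<Union>k\<in>K. T k)"
    unfolding pairwise_def by blast
  moreover have "(\<Union>k\<in>K. \<Union>(T k)) = (\<Union>k\<in>K. R k)" using T by (intro SUP_cong) auto
  then have "\<Union>(\<Union>k\<in>K. T k) = (\<Union>k\<in>K. R k)" by blast
  moreover have "finite (\<Union>k\<in>K. T k)" "\<forall>S\<in>(\<Union>k\<in>K. T k). \<exists>B\<in>\<B>. is_copy B S"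
    using fin T by blast+
  ultimately show ?thesis unfolding can_be_tiled_with_def by blast
qed

lemma is_copy_cube_cbox:
  fixes t :: "real ^ 'n"
  shows "is_copy (cube c) (cbox t (\<chi> i. t $ i + real c))"
proof -
  have "t + (\<chi> i. real c) = (\<chi> i. t $ i + real c)" by (simp add: vec_eq_iff)
  then have "cbox t (\<chi> i. t $ i + real c) = (\<lambda>x. t + mat 1 *v x) ` cube c"
    using cbox_translation[of t 0 "\<chi> i. real c"] by (simp add: cube_def rectangle_def)
  moreover have "rotation_matrix (mat 1 :: real ^ 'n ^ 'n)"
    by (simp add: rotation_matrix_def orthogonal_matrix_id)
  ultimately show ?thesis unfolding is_copy_def by blast
qed

lemma can_be_tiled_with_translated_cube:
  fixes t :: "real ^ 'n"
  assumes "cube c \<in> \<B>"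
  shows "can_be_tiled_with (cbox t (\<chi> i. t $ i + real c)) \<B>"
  unfolding can_be_tiled_with_def
  using assms is_copy_cube_cbox[of c t]
  by (intro exI[of _ "{cbox t (\<chi> i. t $ i + real c)}"]) auto

lemma chain_cell_exists:
  fixes s :: "nat \<Rightarrow> real"
  assumes "s 0 \<le> y" "y \<le> s m" "m > 0"
  shows "\<exists>k<m. s k \<le> y \<and> y \<le> s (Suc k)"
  using assms
proof (induction m)
  case (Suc m)
  show ?case
  \<comment> \<open>In the first case \<open>y\<close> lies in the last cell. The value
    \<open>m = 0\<close> is put there because the induction hypothesis assumes
    \<open>m > 0\<close>.\<close>
  proof (cases "m = 0 \<or> s m \<le> y")
    case True
    then show ?thesis using Suc.prems by blast
  next
    case False
    then show ?thesis using Suc.IH Suc.prems by (metis less_Suc_eq linear)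
  qed
qed simp

lemma chain_mono:
  fixes s :: "nat \<Rightarrow> real"
  assumes "\<And>k. k < m \<Longrightarrow> s k \<le> s (Suc k)" "j \<le> k" "k \<le> m"
  shows "s j \<le> s k"
  using assms(2,3)
proof (induction k rule: dec_induct)
  case (step k)
  then show ?case using assms(1)[of k] by simp
qed simp

text \<open>The cells of a product of subdivisions are indexed by the functions \<open>f\<close>
  that select one segment in each coordinate. The breakpoints may differ between coordinates, so
  that boxes with unequal sides are covered too.\<close>

lemma can_be_tiled_with_grid:
  fixes s :: "'n::finite \<Rightarrow> nat \<Rightarrow> real" and m :: "'n \<Rightarrow> nat"
  assumes mpos: "\<And>i. m i > 0"
    and mono: "\<And>i k. k < m i \<Longrightarrow> s i k \<le> s i (Suc k)"
    and til: "\<And>f. (\<And>i. f i < m i) \<Longrightarrow>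
        can_be_tiled_with (cbox (\<chi> i. s i (f i)) (\<chi> i. s i (Suc (f i))) :: (real ^ 'n) set) \<B>"
  shows "can_be_tiled_with (cbox (\<chi> i. s i 0) (\<chi> i. s i (m i)) :: (real ^ 'n) set) \<B>"
proof -
  define K where "K = {f. \<forall>i. f i < m i}"
  define C where "C f = (cbox (\<chi> i. s i (f i)) (\<chi> i. s i (Suc (f i))) :: (real ^ 'n) set)" for f
  have K: "K = PiE UNIV (\<lambda>i. {..<m i})" by (auto simp: K_def)
  have fin: "finite K" unfolding K by (intro finite_PiE) auto
  have chain: "s i j \<le> s i k" if "j \<le> k" "k \<le> m i" for i j k
    by (rule chain_mono[of "m i" "s i", OF mono that])
  \<comment> \<open>In coordinate \<open>i\<close> the cell of \<open>f\<close> ends no later than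
    the cell of \<open>g\<close> begins, so no point is interior to both.\<close>
  have less: "interior (C f) \<inter> interior (C g) = {}"
    if "f \<in> K" "g \<in> K" "f i < g i" for f g i
  proof -
    have "s i (Suc (f i)) \<le> s i (g i)"
      using that by (simp add: chain K_def less_imp_le)
    moreover have "y $ i < s i (Suc (f i))" if "y \<in> interior (C f)" for y
      using that by (simp add: C_def mem_box_cart)
    moreover have "s i (g i) < y $ i" if "y \<in> interior (C g)" for y
      using that by (simp add: C_def mem_box_cart)
    ultimately show ?thesis by fastforce
  qed
  have dis: "interior (C f) \<inter> interior (C g) = {}" if fg: "f \<in> K" "g \<in> K" "f \<noteq> g" for f g
  proof -
    obtain i where "f i < g i \<or> g i < f i" using \<open>f \<noteq> g\<close> by (metis ext nat_neq_iff)
    then show ?thesis using less fg by blast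
  qed
  have "(\<Union>f\<in>K. C f) = cbox (\<chi> i. s i 0) (\<chi> i. s i (m i))"
  proof (intro equalityI subsetI)
    fix y :: "real ^ 'n"
    assume "y \<in> (\<Union>f\<in>K. C f)"
    then obtain f where f: "f \<in> K" "y \<in> C f" by blast
    have "s i 0 \<le> y $ i \<and> y $ i \<le> s i (m i)" for i
    proof -
      have "f i < m i" using f by (simp add: K_def)
      then have "s i 0 \<le> s i (f i)" "s i (Suc (f i)) \<le> s i (m i)"
        by (simp_all add: chain)
      moreover have "s i (f i) \<le> y $ i" "y $ i \<le> s i (Suc (f i))"
        using f by (auto simp: C_def mem_box_cart)
      ultimately show ?thesis by linarith
    qed
    then show "y \<in> cbox (\<chi> i. s i 0) (\<chi> i. s i (m i))" by (simp add: mem_box_cart)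
  next
    fix y :: "real ^ 'n"
    assume "y \<in> cbox (\<chi> i. s i 0) (\<chi> i. s i (m i))"
    then have "\<exists>k<m i. s i k \<le> y $ i \<and> y $ i \<le> s i (Suc k)" for i
      by (intro chain_cell_exists mpos) (auto simp: mem_box_cart)
    then obtain f where "\<And>i. f i < m i \<and> s i (f i) \<le> y $ i \<and> y $ i \<le> s i (Suc (f i))" by metis
    then show "y \<in> (\<Union>f\<in>K. C f)" by (auto simp: K_def C_def mem_box_cart)
  qed
  moreover have "can_be_tiled_with (\<Union>f\<in>K. C f) \<B>"
    using fin til dis by (intro can_be_tiled_with_UN) (auto simp: K_def C_def)
  ultimately show ?thesis by simp
qed

text \<open>Cutting side \<open>i\<close> into \<open>r i div c\<close> segments of length
  \<open>c\<close> yields a grid of translated cubes. Positive sides give at least one segment in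
  each coordinate, as the grid lemma requires.\<close>

lemma can_be_tiled_with_common_divisor:
  fixes t :: "real ^ 'n" and r :: "'n \<Rightarrow> nat"
  assumes "cube c \<in> \<B>" "\<And>i. c dvd r i" "\<And>i. r i > 0"
  shows "can_be_tiled_with (cbox t (\<chi> i. t $ i + real (r i))) \<B>"
proof -
  define m where "m i = r i div c" for i
  define s where "s i k = t $ i + real c * real k" for i k
  have r: "r i = c * m i" for i using assms(2) by (simp add: m_def)
  have "can_be_tiled_with (cbox (\<chi> i. s i 0) (\<chi> i. s i (m i)) :: (real ^ 'n) set) \<B>"
  proof (rule can_be_tiled_with_grid)
    show "m i > 0" for i using assms(3)[of i] r[of i] by simp
    show "s i k \<le> s i (Suc k)" for i k by (simp add: s_def algebra_simps)
    fix f :: "'n \<Rightarrow> nat"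
    show "can_be_tiled_with (cbox (\<chi> i. s i (f i)) (\<chi> i. s i (Suc (f i))) :: (real ^ 'n) set) \<B>"
      using can_be_tiled_with_translated_cube[OF assms(1), of "\<chi> i. s i (f i)"]
      by (simp add: s_def algebra_simps)
  qed
  then show ?thesis by (simp add: s_def r)
qed

theorem theorem1p4:
  fixes p :: "nat \<Rightarrow> nat" and a :: nat
  assumes "\<And>i. i \<in> {1..CARD('n::finite) + 1} \<Longrightarrow> prime (p i)"
    and "strict_mono_on {1..CARD('n) + 1} p"
    and "a > 0"
    and "real a > real CARD('n) * (\<Prod>i = 1..CARD('n) + 1. real (p i))
                  - (\<Sum>i = 1..CARD('n) + 1. (\<Prod>j = 1..CARD('n) + 1. real (p j)) / real (p i))"
  shows "can_be_tiled_with (cube a :: (real ^ 'n) set) ((\<lambda>i. cube (p i)) ` {1..CARD('n) + 1})"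
proof -
  define I where "I = {1..CARD('n) + 1}"
  define q where "q i = (\<Prod>j\<in>I-{i}. p j)" for i
  have fin: "finite I" and ne: "I \<noteq> {}" and card: "card I = CARD('n) + 1"
    by (auto simp: I_def)
  have prime: "prime (p i)" if "i \<in> I" for i using assms(1) that by (simp add: I_def)
  have pos: "p i > 0" if "i \<in> I" for i using prime[OF that] by (rule prime_gt_0_nat)
  have qpos: "q i > 0" for i unfolding q_def using pos by (intro prod_pos) auto
  have cop: "coprime (p i) (p j)" if "i \<in> I" "j \<in> I" "i \<noteq> j" for i j
  proof -
    have "inj_on p I" unfolding I_def by (rule strict_mono_on_imp_inj_on[OF assms(2)])
    then show ?thesis using that prime by (metis inj_on_def primes_coprime)
  qed
  have quot: "(\<Prod>j\<in>I. real (p j)) / real (p i) = real (q i)" if "i \<in> I" for i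
    using that fin pos[OF that] by (simp add: q_def prod.remove)
  have "(\<Sum>i\<in>I. (\<Prod>j\<in>I. real (p j)) / real (p i)) = (\<Sum>i\<in>I. real (q i))"
    by (intro sum.cong refl quot)
  \<comment> \<open>With each quotient identified as the integer \<open>q i\<close>, the real
    inequality descends to \<open>int\<close>.\<close>
  then have "real_of_int (int a) > real_of_int (int CARD('n) * (\<Prod>i\<in>I. int (p i)) - (\<Sum>i\<in>I. int (q i)))"
    using assms(4)[folded I_def] by simp
  then have "int a > (int (card I) - 1) * (\<Prod>i\<in>I. int (p i)) - (\<Sum>i\<in>I. \<Prod>j\<in>I-{i}. int (p j))"
    unfolding of_int_less_iff card by (simp add: q_def)
  then obtain x where a: "a = (\<Sum>i\<in>I. x i * q i)"
    using frobenius_complementary_products[where p = p, OF fin ne pos cop] unfolding q_def by blast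
  obtain m s where s: "s 0 = 0" "s m = a" "\<And>k. k < m \<Longrightarrow> \<exists>i\<in>I. s (Suc k) = s k + q i"
    using sum_as_chain[OF fin, of x q] unfolding a by blast
  \<comment> \<open>\<open>h k\<close> records which \<open>q i\<close> is the length of the
    \<open>k\<close>-th segment; the same chain is then used in every coordinate.\<close>
  then obtain h where h: "\<And>k. k < m \<Longrightarrow> h k \<in> I \<and> s (Suc k) = s k + q (h k)" by metis
  have "can_be_tiled_with (cbox (\<chi> i. real (s 0)) (\<chi> i. real (s m)) :: (real ^ 'n) set)
      ((\<lambda>i. cube (p i)) ` I)"
  proof (rule can_be_tiled_with_grid)
    \<comment> \<open>\<open>m = 0\<close> would give \<open>a = s 0 = 0\<close>.\<close>
    show "m > 0" using s \<open>a > 0\<close> by (metis gr0I)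
    show "real (s k) \<le> real (s (Suc k))" if "k < m" for k using h[OF that] by simp
    fix f :: "'n \<Rightarrow> nat"
    assume f: "\<And>i. f i < m"
    \<comment> \<open>Pigeonhole: the cell has \<open>CARD('n)\<close> sides, while \<open>I\<close>
      has one index more, so some \<open>j\<close> is used by no side.\<close>
    have "card (range (h \<circ> f)) < card I"
      using card_image_le[of "UNIV :: 'n set" "h \<circ> f"] card by simp
    then have "\<not> I \<subseteq> range (h \<circ> f)" by (meson card_mono finite linorder_not_le finite_imageI)
    then obtain j where j: "j \<in> I" "\<And>i. h (f i) \<noteq> j" by auto
    \<comment> \<open>\<open>q (h (f i))\<close> omits only the factor with index
      \<open>h (f i)\<close>, which differs from \<open>j\<close>.\<close>
    have "p j dvd q (h (f i))" for i
      unfolding q_def using j fin by (intro dvd_prodI) (auto dest: sym)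
    then have "can_be_tiled_with (cbox (\<chi> i. real (s (f i)))
        (\<chi> i. (\<chi> i. real (s (f i))) $ i + real (q (h (f i)))) :: (real ^ 'n) set) ((\<lambda>i. cube (p i)) ` I)"
      using j qpos by (intro can_be_tiled_with_common_divisor[where c = "p j"]) auto
    then show "can_be_tiled_with (cbox (\<chi> i. real (s (f i))) (\<chi> i. real (s (Suc (f i)))) :: (real ^ 'n) set)
        ((\<lambda>i. cube (p i)) ` I)"
      using h f by simp
  qed
  moreover have "(\<chi> i. real (s 0)) = (0 :: real ^ 'n)" by (simp add: s vec_eq_iff)
  ultimately show ?thesis by (simp add: s cube_def rectangle_def I_def)
qed

end
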